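(* Every injective (bounded) unilateral weighted shift on $\ell^2$ is supraposinormal. That is, if $\{w_n\}_{n\geq 0}$ is a bounded sequence of complex numbers and $W \in B(\ell^2)$ is the operator determined by $We_n = w_n e_{n+1}$ for all $n \geq 0$, and if $W$ is injective, then there exist positive operators $P, Q \in B(\ell^2)$, at least one of which has dense range, such that $WQW^* = W^*PW$.
   Context: $\ell^2 = \ell^2(\{0,1,2,\dots\})$ is the complex Hilbert space of square-summable sequences, with standard orthonormal basis $\{e_n\}_{n \geq 0}$. $B(\ell^2)$ denotes the bounded linear operators on $\ell^2$. "Positive" means positive semidefinite. An operator $T \in B(H)$ on a Hilbert space $H$ is supraposinormal if there exist positive operators $P,Q \in B(H)$, at least one of which has dense range, such that $TQT^* = T^*PT$. *)

theory Defs
  imports "HOL-Analysis.Analysis"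
begin

section \<open>The complex Hilbert space of square-summable sequences\<close>

definition square_summable :: "(nat \<Rightarrow> complex) \<Rightarrow> bool" where
  "square_summable x \<longleftrightarrow> summable (\<lambda>n. (cmod (x n))\<^sup>2)"

lemma square_summable_zero: "square_summable (\<lambda>_. 0)"
  by (simp add: square_summable_def)

lemma square_summable_add:
  assumes "square_summable x" "square_summable y"
  shows "square_summable (\<lambda>n. x n + y n)"
  unfolding square_summable_def
proof (rule summable_comparison_test')
  show "summable (\<lambda>n. 2 * (cmod (x n))\<^sup>2 + 2 * (cmod (y n))\<^sup>2)"
    using assms unfolding square_summable_def
    by (intro summable_add summable_mult)
  fix n :: nat
  have "(cmod (x n + y n))\<^sup>2 \<le> (cmod (x n) + cmod (y n))\<^sup>2"
    by (intro power_mono norm_triangle_ineq) auto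
  also have "\<dots> \<le> 2 * (cmod (x n))\<^sup>2 + 2 * (cmod (y n))\<^sup>2"
    using sum_squares_ge_zero[of "cmod (x n) - cmod (y n)" 0]
    by (simp add: power2_eq_square algebra_simps)
  finally show "norm ((cmod (x n + y n))\<^sup>2) \<le> 2 * (cmod (x n))\<^sup>2 + 2 * (cmod (y n))\<^sup>2"
    by simp
qed

lemma square_summable_mult:
  "square_summable x \<Longrightarrow> square_summable (\<lambda>n. c * x n)"
  unfolding square_summable_def
  by (simp add: norm_mult power_mult_distrib summable_mult)

lemma square_summable_finite:
  "finite {n. x n \<noteq> 0} \<Longrightarrow> square_summable x"
  unfolding square_summable_def by (rule summable_finite) auto

lemma summable_mult_cnj:
  assumes "square_summable x" "square_summable y"
  shows "summable (\<lambda>n. x n * cnj (y n))"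
proof (rule summable_comparison_test')
  show "summable (\<lambda>n. (cmod (x n))\<^sup>2 + (cmod (y n))\<^sup>2)"
    using assms unfolding square_summable_def by (rule summable_add)
  fix n :: nat
  have "2 * (cmod (x n) * cmod (y n)) \<le> (cmod (x n))\<^sup>2 + (cmod (y n))\<^sup>2"
    using sum_squares_bound[of "cmod (x n)" "cmod (y n)"] by (simp add: mult.assoc)
  moreover have "0 \<le> cmod (x n) * cmod (y n)" by simp
  ultimately have "cmod (x n) * cmod (y n) \<le> (cmod (x n))\<^sup>2 + (cmod (y n))\<^sup>2"
    by linarith
  then show "norm (x n * cnj (y n)) \<le> (cmod (x n))\<^sup>2 + (cmod (y n))\<^sup>2"
    by (simp add: norm_mult)
qed

typedef ell2 = "{x :: nat \<Rightarrow> complex. square_summable x}"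
  morphisms coord Abs_ell2
  using square_summable_zero by blast

setup_lifting type_definition_ell2

lemma square_summable_coord: "square_summable (coord x)"
  using coord by blast

lift_definition scaleC :: "complex \<Rightarrow> ell2 \<Rightarrow> ell2" (infixr "*\<^sub>C" 75)
  is "\<lambda>c x n. c * x n" by (rule square_summable_mult)

text \<open>The complex inner product is linear in its first argument.\<close>

lift_definition cinner :: "ell2 \<Rightarrow> ell2 \<Rightarrow> complex"
  is "\<lambda>x y. \<Sum>n. x n * cnj (y n)" .

lift_definition basis_vec :: "nat \<Rightarrow> ell2"
  is "\<lambda>k n. if n = k then 1 else 0"
  by (rule square_summable_finite) auto

instantiation ell2 :: real_vector
begin

lift_definition zero_ell2 :: ell2 is "\<lambda>_. 0" by (rule square_summable_zero)

lift_definition plus_ell2 :: "ell2 \<Rightarrow> ell2 \<Rightarrow> ell2" is "\<lambda>x y n. x n + y n"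
  by (rule square_summable_add)

lift_definition uminus_ell2 :: "ell2 \<Rightarrow> ell2" is "\<lambda>x n. - x n"
  by (simp add: square_summable_def)

lift_definition minus_ell2 :: "ell2 \<Rightarrow> ell2 \<Rightarrow> ell2" is "\<lambda>x y n. x n - y n"
  subgoal for x y
    using square_summable_add[of x "\<lambda>n. - y n"] by (simp add: square_summable_def)
  done

lift_definition scaleR_ell2 :: "real \<Rightarrow> ell2 \<Rightarrow> ell2" is "\<lambda>r x n. complex_of_real r * x n"
  by (rule square_summable_mult)

instance
proof
  fix x y z :: ell2 and r s :: real
  show "x + y + z = x + (y + z)" by transfer (simp add: algebra_simps)
  show "x + y = y + x" by transfer (simp add: algebra_simps)
  show "0 + x = x" by transfer simp
  show "- x + x = 0" by transfer simp
  show "x - y = x + - y" by transfer simp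
  show "r *\<^sub>R (x + y) = r *\<^sub>R x + r *\<^sub>R y" by transfer (simp add: algebra_simps)
  show "(r + s) *\<^sub>R x = r *\<^sub>R x + s *\<^sub>R x" by transfer (simp add: algebra_simps)
  show "r *\<^sub>R s *\<^sub>R x = (r * s) *\<^sub>R x" by transfer (simp add: algebra_simps)
  show "1 *\<^sub>R x = x" by transfer simp
qed

end

text \<open>
  The real inner product below is the real part of \<^const>\<open>cinner\<close>. It induces the usual
  norm and topology, so \<^const>\<open>bounded_linear\<close> and \<^const>\<open>closure\<close> have
  their usual meaning on this type.
\<close>

instantiation ell2 :: real_inner
begin

lift_definition norm_ell2 :: "ell2 \<Rightarrow> real" is "\<lambda>x. sqrt (\<Sum>n. (cmod (x n))\<^sup>2)" .

definition inner_ell2 :: "ell2 \<Rightarrow> ell2 \<Rightarrow> real" where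
  "inner_ell2 x y = Re (cinner x y)"

definition sgn_ell2 :: "ell2 \<Rightarrow> ell2" where "sgn_ell2 x = x /\<^sub>R norm x"

definition dist_ell2 :: "ell2 \<Rightarrow> ell2 \<Rightarrow> real" where "dist_ell2 x y = norm (x - y)"

definition uniformity_ell2 :: "(ell2 \<times> ell2) filter" where
  "uniformity_ell2 = (INF e\<in>{0<..}. principal {(x, y). dist x y < e})"

definition open_ell2 :: "ell2 set \<Rightarrow> bool" where
  "open_ell2 U \<longleftrightarrow> (\<forall>x\<in>U. eventually (\<lambda>(x', y). x' = x \<longrightarrow> y \<in> U) uniformity)"

lemma inner_ell2_sums:
  "(\<lambda>n. Re (coord x n * cnj (coord y n))) sums inner x y"
  unfolding inner_ell2_def cinner.rep_eq
  by (intro sums_Re summable_sums summable_mult_cnj square_summable_coord)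

lemma inner_ell2_self: "inner x x = (\<Sum>n. (cmod (coord x n))\<^sup>2)" for x :: ell2
proof -
  have "Re (coord x n * cnj (coord x n)) = (cmod (coord x n))\<^sup>2" for n
    by (simp only: complex_norm_square[symmetric] Re_complex_of_real)
  then show ?thesis using inner_ell2_sums[of x x, THEN sums_unique] by simp
qed

instance
proof
  fix x y :: ell2
  show "dist x y = norm (x - y)" by (rule dist_ell2_def)
  show "sgn x = x /\<^sub>R norm x" by (rule sgn_ell2_def)
  show "uniformity = (INF e\<in>{0<..}. principal {(x, y :: ell2). dist x y < e})"
    by (rule uniformity_ell2_def)
  fix U :: "ell2 set"
  show "open U \<longleftrightarrow> (\<forall>x\<in>U. eventually (\<lambda>(x', y). x' = x \<longrightarrow> y \<in> U) uniformity)"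
    by (rule open_ell2_def)
next
  fix x y z :: ell2 and r :: real
  have "(\<lambda>n. Re (coord y n * cnj (coord x n))) = (\<lambda>n. Re (coord x n * cnj (coord y n)))"
    by (simp add: mult.commute)
  then show "inner x y = inner y x"
    using inner_ell2_sums[of x y] inner_ell2_sums[of y x] by (metis sums_unique2)
  show "inner (x + y) z = inner x z + inner y z"
  proof (rule sums_unique2[OF inner_ell2_sums])
    show "(\<lambda>n. Re (coord (x + y) n * cnj (coord z n))) sums (inner x z + inner y z)"
      using sums_add[OF inner_ell2_sums[of x z] inner_ell2_sums[of y z]]
      by (simp add: plus_ell2.rep_eq algebra_simps)
  qed
  show "inner (r *\<^sub>R x) y = r * inner x y"
  proof (rule sums_unique2[OF inner_ell2_sums])
    show "(\<lambda>n. Re (coord (r *\<^sub>R x) n * cnj (coord y n))) sums (r * inner x y)"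
      using sums_mult[OF inner_ell2_sums[of x y], of r]
      by (simp add: scaleR_ell2.rep_eq algebra_simps)
  qed
  have s: "summable (\<lambda>n. (cmod (coord x n))\<^sup>2)"
    using square_summable_coord square_summable_def by blast
  show "0 \<le> inner x x"
    unfolding inner_ell2_self by (rule suminf_nonneg[OF s]) simp
  show "inner x x = 0 \<longleftrightarrow> x = 0"
    unfolding inner_ell2_self using suminf_eq_zero_iff[OF s]
    by (auto simp: coord_inject[symmetric] zero_ell2.rep_eq fun_eq_iff)
  show "norm x = sqrt (inner x x)"
    unfolding inner_ell2_self by (rule norm_ell2.rep_eq)
qed

end

section \<open>Bounded operators, adjoints, positivity\<close>

definition bounded_operator :: "(ell2 \<Rightarrow> ell2) \<Rightarrow> bool" where
  "bounded_operator T \<longleftrightarrow> bounded_linear T \<and> (\<forall>c x. T (c *\<^sub>C x) = c *\<^sub>C T x)"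

definition cadjoint :: "(ell2 \<Rightarrow> ell2) \<Rightarrow> ell2 \<Rightarrow> ell2" where
  "cadjoint T = (THE S. \<forall>x y. cinner (T x) y = cinner x (S y))"

definition positive_operator :: "(ell2 \<Rightarrow> ell2) \<Rightarrow> bool" where
  "positive_operator T \<longleftrightarrow> bounded_operator T \<and> (\<forall>x. cinner (T x) x \<in> \<real>\<^sub>\<ge>\<^sub>0)"

definition dense_range :: "(ell2 \<Rightarrow> ell2) \<Rightarrow> bool" where
  "dense_range T \<longleftrightarrow> closure (range T) = UNIV"

definition supraposinormal :: "(ell2 \<Rightarrow> ell2) \<Rightarrow> bool" where
  "supraposinormal T \<longleftrightarrow> bounded_operator T \<and>
     (\<exists>P Q. positive_operator P \<and> positive_operator Q \<and> (dense_range P \<or> dense_range Q) \<and>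
            T \<circ> Q \<circ> cadjoint T = cadjoint T \<circ> P \<circ> T)"

section \<open>Existence and uniqueness of adjoints\<close>

lemma cinner_add_left: "cinner (x + y) z = cinner x z + cinner y z"
  unfolding cinner.rep_eq
  by (subst suminf_add)
     (simp_all add: plus_ell2.rep_eq algebra_simps summable_mult_cnj square_summable_coord)

lemma cinner_scaleC_left: "cinner (c *\<^sub>C x) y = c * cinner x y"
  unfolding cinner.rep_eq
  by (subst suminf_mult[symmetric])
     (simp_all add: scaleC.rep_eq algebra_simps summable_mult_cnj square_summable_coord)

lemma scaleR_eq_scaleC: "r *\<^sub>R x = complex_of_real r *\<^sub>C x" for x :: ell2
  by transfer simp

lemma cinner_basis_left: "cinner (basis_vec n) y = cnj (coord y n)"
proof -
  have "(\<lambda>k. coord (basis_vec n) k * cnj (coord y k)) =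
        (\<lambda>k. if k = n then cnj (coord y k) else 0)"
    by (auto simp: basis_vec.rep_eq)
  then show ?thesis
    unfolding cinner.rep_eq using sums_unique[OF sums_single[of n "\<lambda>k. cnj (coord y k)"]] by simp
qed

lemma Re_cinner_le: "Re (cinner x y) \<le> norm x * norm y"
  using norm_cauchy_schwarz[of x y] by (simp add: inner_ell2_def)

lemma cmod_cinner_le: "cmod (cinner x y) \<le> norm x * norm y"
proof -
  obtain c where c: "cmod c = 1" "c * cinner x y = complex_of_real (cmod (cinner x y))"
  proof (cases "cinner x y = 0")
    case True
    then show ?thesis using that[of 1] by simp
  next
    case False
    show ?thesis
    proof (rule that)
      show "cmod (cnj (cinner x y) / cmod (cinner x y)) = 1"
        using False by (simp add: norm_divide)
      show "cnj (cinner x y) / cmod (cinner x y) * cinner x y = cmod (cinner x y)"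
        using False complex_norm_square[of "cinner x y"]
        by (simp add: field_simps power2_eq_square)
    qed
  qed
  have "norm (c *\<^sub>C x) = norm x"
    using c(1) by (simp add: norm_ell2.rep_eq scaleC.rep_eq norm_mult)
  then show ?thesis
    using Re_cinner_le[of "c *\<^sub>C x" y] c(2) by (simp add: cinner_scaleC_left)
qed

lift_definition truncate :: "nat \<Rightarrow> ell2 \<Rightarrow> ell2"
  is "\<lambda>N x n. if n < N then x n else 0"
  by (rule square_summable_finite) (auto intro: finite_subset[of _ "{..<_}"])

lemma truncate_tendsto: "(\<lambda>N. truncate N x) \<longlonglongrightarrow> x"
proof -
  have s: "summable (\<lambda>n. (cmod (coord x n))\<^sup>2)"
    using square_summable_coord square_summable_def by blast
  have "norm (truncate N x - x) = sqrt (\<Sum>n. (cmod (coord x (n + N)))\<^sup>2)" for N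
  proof -
    have "summable (\<lambda>n. (cmod (coord (truncate N x - x) n))\<^sup>2)"
      using square_summable_coord square_summable_def by blast
    from suminf_split_initial_segment[OF this, of N]
    have "(\<Sum>n. (cmod (coord (truncate N x - x) n))\<^sup>2) = (\<Sum>n. (cmod (coord x (n + N)))\<^sup>2)"
      by (simp add: minus_ell2.rep_eq truncate.rep_eq)
    then show ?thesis by (simp add: norm_ell2.rep_eq)
  qed
  moreover have "(\<lambda>N. sqrt (\<Sum>n. (cmod (coord x (n + N)))\<^sup>2)) \<longlonglongrightarrow> sqrt 0"
    by (intro tendsto_real_sqrt suminf_exist_split2[OF s])
  ultimately have "(\<lambda>N. norm (truncate N x - x)) \<longlonglongrightarrow> 0" by simp
  then show ?thesis
    by (metis LIM_zero_cancel tendsto_norm_zero_cancel)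
qed

lemma truncate_Suc: "truncate (Suc N) x = truncate N x + coord x N *\<^sub>C basis_vec N"
  by transfer (auto simp: fun_eq_iff less_Suc_eq)

lemma truncate_0: "truncate 0 x = 0"
  by transfer simp

lemma cinner_truncate:
  assumes T: "bounded_operator T"
  shows "cinner (T (truncate N x)) y = (\<Sum>n<N. coord x n * cinner (T (basis_vec n)) y)"
proof (induction N)
  case 0
  have "cinner 0 y = 0" by transfer simp
  then show ?case
    using T by (simp add: truncate_0 bounded_operator_def bounded_linear.linear linear_0)
next
  case (Suc N)
  then show ?case
    using T by (simp add: truncate_Suc bounded_operator_def bounded_linear.linear linear_add
        cinner_add_left cinner_scaleC_left)
qed

lemma adjoint_exists:
  assumes T: "bounded_operator T"
  shows "\<exists>z. \<forall>x. cinner (T x) y = cinner x z"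
proof -
  define a where "a n = cnj (cinner (T (basis_vec n)) y)" for n
  obtain K where K: "\<And>x. norm (T x) \<le> norm x * K" "K \<ge> 0"
    using T unfolding bounded_operator_def
    using bounded_linear.nonneg_bounded by blast
  have bound: "(\<Sum>n<N. (cmod (a n))\<^sup>2) \<le> (K * norm y)\<^sup>2" for N
  proof -
    define s where "s = (\<Sum>n<N. (cmod (a n))\<^sup>2)"
    have s0: "s \<ge> 0" unfolding s_def by (intro sum_nonneg) auto
    define f where "f n = (if n < N then a n else 0)" for n
    have f: "square_summable f"
      unfolding f_def by (rule square_summable_finite) (auto intro: finite_subset[of _ "{..<N}"])
    define z where "z = Abs_ell2 f"
    have cz: "coord z = f" unfolding z_def using f by (simp add: Abs_ell2_inverse)
    have tz: "truncate N z = z"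
      by (rule coord_inject[THEN iffD1]) (auto simp: truncate.rep_eq cz f_def)
    have "(\<Sum>n. (cmod (f n))\<^sup>2) = s"
      unfolding s_def by (subst suminf_finite[of "{..<N}"]) (auto simp: f_def)
    then have nz: "norm z = sqrt s" by (simp add: norm_ell2.rep_eq cz)
    have "cinner (T z) y = (\<Sum>n<N. a n * cnj (a n))"
      using cinner_truncate[OF T, of N z y] by (simp add: tz cz f_def a_def)
    also have "\<dots> = complex_of_real s"
      unfolding s_def by (simp add: complex_norm_square[symmetric])
    finally have "s \<le> norm (T z) * norm y"
      using Re_cinner_le[of "T z" y] by simp
    also have "\<dots> \<le> sqrt s * (K * norm y)"
      using mult_right_mono[OF K(1)[of z], of "norm y"] by (simp add: nz mult.assoc)
    finally have le: "sqrt s * sqrt s \<le> sqrt s * (K * norm y)" using s0 by simp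
    have "sqrt s \<le> K * norm y"
    proof (cases "s = 0")
      case True
      then show ?thesis using K(2) by simp
    next
      case False
      then have "sqrt s > 0" using s0 by simp
      then show ?thesis using le mult_le_cancel_left_pos by blast
    qed
    then have "(sqrt s)\<^sup>2 \<le> (K * norm y)\<^sup>2"
      using s0 by (intro power_mono) auto
    then show ?thesis using s0 by (simp add: s_def)
  qed
  have "square_summable a"
    unfolding square_summable_def by (rule summableI_nonneg_bounded[OF _ bound]) auto
  then have ca: "coord (Abs_ell2 a) = a" by (simp add: Abs_ell2_inverse)
  show ?thesis
  proof (intro exI allI)
    fix x
    have "summable (\<lambda>n. coord x n * cnj (a n))"
      using summable_mult_cnj[OF square_summable_coord \<open>square_summable a\<close>] .
    then have 1: "(\<lambda>N. \<Sum>n<N. coord x n * cnj (a n)) \<longlonglongrightarrow> cinner x (Abs_ell2 a)"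
      unfolding cinner.rep_eq ca by (rule summable_LIMSEQ)
    have "(\<lambda>N. cinner (T (truncate N x)) y - cinner (T x) y) \<longlonglongrightarrow> 0"
    proof (rule Lim_null_comparison)
      have "(\<lambda>N. norm (truncate N x - x)) \<longlonglongrightarrow> 0"
        using truncate_tendsto LIM_zero tendsto_norm_zero by blast
      then have "(\<lambda>N. norm (truncate N x - x) * (K * norm y)) \<longlonglongrightarrow> 0"
        by (rule tendsto_mult_left_zero)
      then show "(\<lambda>N. norm (truncate N x - x) * K * norm y) \<longlonglongrightarrow> 0"
        by (simp add: mult.assoc)
      have "norm (cinner (T (truncate N x)) y - cinner (T x) y)
              \<le> norm (truncate N x - x) * K * norm y" for N
      proof -
        have "T (truncate N x) = T (truncate N x - x) + T x"
          using T by (simp add: bounded_operator_def bounded_linear.linear linear_diff)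
        then have "cinner (T (truncate N x)) y - cinner (T x) y = cinner (T (truncate N x - x)) y"
          by (metis add_diff_cancel_right' cinner_add_left)
        then have "norm (cinner (T (truncate N x)) y - cinner (T x) y)
              \<le> norm (T (truncate N x - x)) * norm y"
          by (simp add: cmod_cinner_le)
        also have "\<dots> \<le> norm (truncate N x - x) * K * norm y"
          by (rule mult_right_mono[OF K(1)]) simp
        finally show ?thesis .
      qed
      then show "\<forall>\<^sub>F N in sequentially. norm (cinner (T (truncate N x)) y - cinner (T x) y)
              \<le> norm (truncate N x - x) * K * norm y" by simp
    qed
    then have "(\<lambda>N. cinner (T (truncate N x)) y) \<longlonglongrightarrow> cinner (T x) y"
      by (rule LIM_zero_cancel)
    then have "(\<lambda>N. \<Sum>n<N. coord x n * cnj (a n)) \<longlonglongrightarrow> cinner (T x) y"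
      by (simp add: cinner_truncate[OF T] a_def)
    with 1 show "cinner (T x) y = cinner x (Abs_ell2 a)"
      using LIMSEQ_unique by blast
  qed
qed

lemma cinner_right_eqI: "(\<And>x. cinner x y = cinner x z) \<Longrightarrow> y = z"
  using cinner_basis_left coord_inject complex_cnj_cancel_iff by (metis ext)

lemma cadjoint_eqI:
  assumes "\<And>x y. cinner (T x) y = cinner x (S y)"
  shows "cadjoint T = S"
  unfolding cadjoint_def
proof (rule the_equality)
  show "\<forall>x y. cinner (T x) y = cinner x (S y)" using assms by blast
  fix S' assume "\<forall>x y. cinner (T x) y = cinner x (S' y)"
  then show "S' = S" using assms by (intro ext cinner_right_eqI) simp
qed

lemma cinner_cadjoint:
  assumes "bounded_operator T"
  shows "cinner (T x) y = cinner x (cadjoint T y)"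
proof -
  obtain S where "\<And>x y. cinner (T x) y = cinner x (S y)"
    using adjoint_exists[OF assms] by metis
  then show ?thesis using cadjoint_eqI[of T S] by simp
qed

end

theory Submission
  imports Defs
begin

text \<open>
  Diagonal \<open>P\<close> and \<open>Q\<close> suffice. If \<open>P\<close> and \<open>Q\<close> have diagonals \<open>p\<close> and \<open>q\<close>, then both
  \<open>W Q W*\<close> and \<open>W* P W\<close> are diagonal; the former has entries \<open>0\<close> and
  \<open>|w n|\<^sup>2 q n\<close> at \<open>n + 1\<close>, the latter \<open>|w n|\<^sup>2 p (n + 1)\<close> at \<open>n\<close>. They agree for
  \<open>q n = |w (n + 1)|\<^sup>2\<close>, \<open>p (n + 2) = |w n|\<^sup>2\<close> and \<open>p 1 = 0\<close>. Injectivity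
  of \<open>W\<close> makes every \<open>q n\<close> nonzero, so \<open>Q\<close> has dense range, whereas \<open>P\<close> never does.
\<close>

lemma ell2_eqI: "(\<And>n. coord x n = coord y n) \<Longrightarrow> x = y"
  by (metis coord_inject ext)

lemma coord_eq_cinner: "coord x n = cinner x (basis_vec n)"
proof -
  have "(\<lambda>k. coord x k * cnj (coord (basis_vec n) k)) = (\<lambda>k. if k = n then coord x k else 0)"
    by (auto simp: basis_vec.rep_eq)
  then show ?thesis
    unfolding cinner.rep_eq using sums_unique[OF sums_single[of n "coord x"]] by simp
qed

lemma cinner_scaleC_right: "cinner x (c *\<^sub>C y) = cnj c * cinner x y"
  unfolding cinner.rep_eq
  by (subst suminf_mult[symmetric])
     (simp_all add: scaleC.rep_eq algebra_simps summable_mult_cnj square_summable_coord)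

text \<open>Defined through \<open>Abs_ell2\<close>, since for unbounded \<open>d\<close> the
  product sequence may leave \<open>ell2\<close>; the coordinate formula is therefore proved only
  where \<open>d\<close> is bounded.\<close>

definition diag_op :: "(nat \<Rightarrow> real) \<Rightarrow> ell2 \<Rightarrow> ell2" where
  "diag_op d x = Abs_ell2 (\<lambda>n. complex_of_real (d n) * coord x n)"

context
  fixes d :: "nat \<Rightarrow> real"
  assumes bdd: "bounded (range d)"
begin

text \<open>One \<open>K\<close> serves all \<open>x\<close> and \<open>n\<close>, so this estimate
  yields both square-summability of the image and the operator norm bound.\<close>

lemma diag_op_bound:
  obtains K where "K \<ge> 0"
    "\<And>x n. (cmod (complex_of_real (d n) * coord x n))\<^sup>2 \<le> K\<^sup>2 * (cmod (coord x n))\<^sup>2"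
proof -
  obtain K where K: "K > 0" "\<And>n. \<bar>d n\<bar> \<le> K"
    using bdd unfolding bounded_pos by auto
  have "(cmod (complex_of_real (d n) * coord x n))\<^sup>2 \<le> K\<^sup>2 * (cmod (coord x n))\<^sup>2" for x n
    using K by (auto simp: norm_mult power_mult_distrib abs_le_square_iff[symmetric]
        intro!: mult_right_mono)
  with K(1) show ?thesis using that[of K] by auto
qed

lemma coord_diag_op: "coord (diag_op d x) n = complex_of_real (d n) * coord x n"
proof -
  obtain K where K: "\<And>x n. (cmod (complex_of_real (d n) * coord x n))\<^sup>2 \<le> K\<^sup>2 * (cmod (coord x n))\<^sup>2"
    using diag_op_bound by metis
  have "summable (\<lambda>n. K\<^sup>2 * (cmod (coord x n))\<^sup>2)"
    using square_summable_coord[of x] by (simp add: square_summable_def)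
  then have "square_summable (\<lambda>n. complex_of_real (d n) * coord x n)"
    unfolding square_summable_def
    by (rule summable_comparison_test') (use K in simp)
  then show ?thesis
    by (simp add: diag_op_def Abs_ell2_inverse)
qed

lemma bounded_operator_diag_op: "bounded_operator (diag_op d)"
proof -
  obtain K where K: "K \<ge> 0"
    "\<And>x n. (cmod (complex_of_real (d n) * coord x n))\<^sup>2 \<le> K\<^sup>2 * (cmod (coord x n))\<^sup>2"
    using diag_op_bound by metis
  have "norm (diag_op d x) \<le> norm x * K" for x
  proof -
    have s: "summable (\<lambda>n. (cmod (coord y n))\<^sup>2)" for y
      using square_summable_coord[of y] by (simp add: square_summable_def)
    have "(\<Sum>n. (cmod (coord (diag_op d x) n))\<^sup>2) \<le> (\<Sum>n. K\<^sup>2 * (cmod (coord x n))\<^sup>2)"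
      using K(2)[of _ x] by (intro suminf_le summable_mult s) (simp add: coord_diag_op)
    also have "\<dots> = K\<^sup>2 * (\<Sum>n. (cmod (coord x n))\<^sup>2)"
      using s by (simp add: suminf_mult)
    finally have "norm (diag_op d x) \<le> sqrt (K\<^sup>2 * (\<Sum>n. (cmod (coord x n))\<^sup>2))"
      by (simp add: norm_ell2.rep_eq)
    with K(1) show ?thesis
      by (simp add: norm_ell2.rep_eq real_sqrt_mult mult.commute)
  qed
  then have "bounded_linear (diag_op d)"
    by (intro bounded_linear_intro[where K = K] ell2_eqI)
       (simp_all add: coord_diag_op plus_ell2.rep_eq scaleR_ell2.rep_eq algebra_simps)
  moreover have "diag_op d (c *\<^sub>C x) = c *\<^sub>C diag_op d x" for c x
    by (rule ell2_eqI) (simp add: coord_diag_op scaleC.rep_eq)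
  ultimately show ?thesis by (simp add: bounded_operator_def)
qed

lemma positive_operator_diag_op:
  assumes "\<And>n. d n \<ge> 0"
  shows "positive_operator (diag_op d)"
proof -
  have "cinner (diag_op d x) x \<in> \<real>\<^sub>\<ge>\<^sub>0" for x
  proof -
    have eq: "coord (diag_op d x) n * cnj (coord x n)
        = complex_of_real (d n * (cmod (coord x n))\<^sup>2)" for n
      by (simp only: coord_diag_op mult.assoc complex_norm_square of_real_mult)
    \<comment> \<open>Convergence is inherited from the inner product series, then passed to the
      reals, where the sum is visibly nonnegative.\<close>
    have "summable (\<lambda>n. complex_of_real (d n * (cmod (coord x n))\<^sup>2))"
      unfolding eq[symmetric] by (intro summable_mult_cnj square_summable_coord)
    then have s: "summable (\<lambda>n. d n * (cmod (coord x n))\<^sup>2)"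
      by (simp only: summable_complex_of_real)
    have "cinner (diag_op d x) x = complex_of_real (\<Sum>n. d n * (cmod (coord x n))\<^sup>2)"
      unfolding cinner.rep_eq eq using suminf_of_real[OF s] by (rule sym)
    moreover have "(\<Sum>n. d n * (cmod (coord x n))\<^sup>2) \<ge> 0"
      using assms by (intro suminf_nonneg[OF s]) simp
    ultimately show ?thesis by simp
  qed
  then show ?thesis by (simp add: positive_operator_def bounded_operator_diag_op)
qed

text \<open>Each truncation of \<open>x\<close> has a preimage, got by dividing coordinates by
  \<open>d\<close>. Finite support keeps it square-summable even when \<open>1 / d\<close> is
  unbounded, and truncations converge to \<open>x\<close>.\<close>

lemma dense_range_diag_op:
  assumes "\<And>n. d n \<noteq> 0"
  shows "dense_range (diag_op d)"
proof -
  have "truncate N x \<in> range (diag_op d)" for N x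
  proof -
    define f where "f n = (if n < N then coord x n / complex_of_real (d n) else 0)" for n
    have "square_summable f"
      unfolding f_def by (rule square_summable_finite) (auto intro: finite_subset[of _ "{..<N}"])
    then have "coord (Abs_ell2 f) = f" by (simp add: Abs_ell2_inverse)
    then have "truncate N x = diag_op d (Abs_ell2 f)"
      using assms by (intro ell2_eqI) (simp add: coord_diag_op truncate.rep_eq f_def)
    then show ?thesis by simp
  qed
  then have "x \<in> closure (range (diag_op d))" for x
    using truncate_tendsto[of x] by (auto intro!: exI[of _ "\<lambda>N. truncate N x"] simp: closure_sequential)
  then show ?thesis by (auto simp: dense_range_def)
qed

end

context
  fixes w :: "nat \<Rightarrow> complex" and W :: "ell2 \<Rightarrow> ell2"
  assumes W: "bounded_operator W"
    and shift: "\<And>n. W (basis_vec n) = w n *\<^sub>C basis_vec (Suc n)"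
begin

lemma coord_cadjoint_shift: "coord (cadjoint W y) n = cnj (w n) * coord y (Suc n)"
proof -
  have "cnj (coord (cadjoint W y) n) = cinner (W (basis_vec n)) y"
    by (simp add: cinner_cadjoint[OF W] cinner_basis_left)
  also have "\<dots> = w n * cnj (coord y (Suc n))"
    by (simp add: shift cinner_scaleC_left cinner_basis_left)
  finally show ?thesis
    by (metis complex_cnj_cnj complex_cnj_mult)
qed

text \<open>\<open>W\<close> is known only on basis vectors. Pairing \<open>W x\<close> with
  \<open>basis_vec n\<close> and moving \<open>W\<close> across turns coordinate \<open>n\<close>
  into the pairing of \<open>x\<close> with \<open>cadjoint W (basis_vec n)\<close>, which is a
  multiple of one basis vector.\<close>

lemma coord_shift: "coord (W x) n = (case n of 0 \<Rightarrow> 0 | Suc m \<Rightarrow> w m * coord x m)"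
proof -
  \<comment> \<open>Zero is written as a scalar multiple so that \<open>cinner_scaleC_right\<close>
    covers both cases.\<close>
  have "cadjoint W (basis_vec n)
      = (case n of 0 \<Rightarrow> 0 *\<^sub>C basis_vec 0 | Suc m \<Rightarrow> cnj (w m) *\<^sub>C basis_vec m)"
    by (rule ell2_eqI)
       (auto simp: coord_cadjoint_shift basis_vec.rep_eq scaleC.rep_eq split: nat.split)
  then have "cinner x (cadjoint W (basis_vec n))
      = (case n of 0 \<Rightarrow> 0 | Suc m \<Rightarrow> w m * coord x m)"
    by (auto simp: cinner_scaleC_right coord_eq_cinner[of x] split: nat.split)
  then show ?thesis
    by (simp only: coord_eq_cinner[of "W x"] cinner_cadjoint[OF W])
qed

text \<open>A zero weight would make \<open>W\<close> send both \<open>basis_vec n\<close> and 0 to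
  0.\<close>

lemma inj_shift_weight_nonzero:
  assumes "inj W"
  shows "w n \<noteq> 0"
proof
  assume "w n = 0"
  then have "W (basis_vec n) = W 0"
    by (intro ell2_eqI)
       (auto simp: shift coord_shift scaleC.rep_eq zero_ell2.rep_eq split: nat.split)
  then have "coord (basis_vec n) n = coord 0 n"
    using assms by (simp add: inj_eq)
  then show False
    by (simp add: basis_vec.rep_eq zero_ell2.rep_eq)
qed

end

theorem corollary4:
  fixes w :: "nat \<Rightarrow> complex" and W :: "ell2 \<Rightarrow> ell2"
  assumes "bounded (range w)"
    and "bounded_operator W"
    and "\<And>n. W (basis_vec n) = w n *\<^sub>C basis_vec (Suc n)"
    and "inj W"
  shows "supraposinormal W"
proof -
  define q where "q n = (cmod (w (Suc n)))\<^sup>2" for n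
  \<comment> \<open>The value at 1 must vanish because \<open>W Q W* x\<close> has coordinate 0
    equal to 0; the value at 0 is a free choice because every \<open>W x\<close> does too.\<close>
  define p where "p n = (if n < 2 then 0 else (cmod (w (n - 2)))\<^sup>2)" for n
  obtain B where B: "\<And>n. cmod (w n) \<le> B"
    using assms(1) unfolding bounded_iff by auto
  have B2: "(cmod (w n))\<^sup>2 \<le> B\<^sup>2" for n
    using B by (intro power_mono) auto
  have bq: "bounded (range q)"
    unfolding bounded_iff q_def using B2 by auto
  have bp: "bounded (range p)"
    unfolding bounded_iff p_def using B2 by (auto intro!: exI[of _ "B\<^sup>2"])
  note coords = coord_shift[OF assms(2,3)] coord_cadjoint_shift[OF assms(2,3)]
    coord_diag_op[OF bq] coord_diag_op[OF bp]
  \<comment> \<open>Squared moduli become products, so that comparing coordinates is commutative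
    algebra.\<close>
  have cp: "complex_of_real (p (Suc (Suc n))) = w n * cnj (w n)"
    and cq: "complex_of_real (q n) = w (Suc n) * cnj (w (Suc n))" for n
    by (simp_all only: p_def q_def complex_norm_square[symmetric]) simp
  have "W \<circ> diag_op q \<circ> cadjoint W = cadjoint W \<circ> diag_op p \<circ> W"
  proof (intro ext ell2_eqI)
    fix x n
    show "coord ((W \<circ> diag_op q \<circ> cadjoint W) x) n = coord ((cadjoint W \<circ> diag_op p \<circ> W) x) n"
      \<comment> \<open>At 0 both sides vanish, the right one by \<open>p 1 = 0\<close>; at
        \<open>Suc m\<close> both are \<open>|w m|^2 |w (Suc m)|^2\<close> times
        \<open>coord x (Suc m)\<close>.\<close>
      by (cases n; cases "n - 1") (simp_all add: coords cp cq p_def[of "Suc 0"])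
  qed
  moreover have "positive_operator (diag_op p)" "positive_operator (diag_op q)"
    by (auto intro!: positive_operator_diag_op bp bq simp: p_def q_def)
  moreover have "dense_range (diag_op q)"
    using inj_shift_weight_nonzero[OF assms(2,3,4)]
    by (intro dense_range_diag_op bq) (simp add: q_def)
  ultimately show ?thesis
    unfolding supraposinormal_def using assms(2) by blast
qed

end
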